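(* Let $A\in\mathbb{R}^{n\times n}$, $B\in\mathbb{R}^{n\times m}$, $K\in\mathbb{R}^{m\times n}$ be such that $(A,B)$ is stabilizable and $A_{cl}=A-BK$ is Hurwitz. Let $Q\in\mathbb{R}^{n\times n}$ be symmetric positive definite and let $P$ be the unique symmetric positive definite solution of $A_{cl}^\top P+PA_{cl}=-Q$. Let $\sigma\in(0,1)$ and consider the event-triggered closed-loop system $$\dot x(t)=Ax(t)-BKx(t_k),\qquad t\in[t_k,t_{k+1}),$$ where, with $e(t)=x(t)-x(t_k)$, the transmission instants $t_k$ are generated by the rule that an event is triggered when $$\sigma\, x(t)^\top P x(t)-2\,x(t)^\top PBK\,e(t)\le 0 .$$ If $$\sigma<\frac{\lambda_{\min}(Q)}{\lambda_{\max}(P)},$$ then this triggering rule guarantees global asymptotic stability of the origin.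
   Context: $\lambda_{\min}(\cdot)$ and $\lambda_{\max}(\cdot)$ denote the smallest and largest eigenvalues of a symmetric matrix. The plant is $\dot x=Ax+Bu$, $x(t)\in\mathbb{R}^n$, $u(t)\in\mathbb{R}^m$, with zero-order-hold input $u(t)=-Kx(t_k)$ for $t\in[t_k,t_{k+1})$, where $\{t_k\}_{k=0}^\infty$ is the sequence of transmission instants; equivalently $\dot x=A_{cl}x+BKe$, where $e(t)=x(t)-x(t_k)$ is the sampling-induced error. When an event is triggered, the current state is transmitted and becomes the new held state, so the error resets to zero; thus $t_{k+1}$ is the next time after $t_k$ at which the triggering inequality holds. *)

theory Defs
  imports "HOL-Analysis.Analysis"
begin

definition is_eigenvalue :: "'a::field^'n^'n \<Rightarrow> 'a \<Rightarrow> bool" where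
  "is_eigenvalue M l \<longleftrightarrow> (\<exists>v. v \<noteq> 0 \<and> M *v v = l *s v)"

definition complexify :: "real^'n^'m \<Rightarrow> complex^'n^'m" where
  "complexify M = (\<chi> i j. complex_of_real (M $ i $ j))"

definition hurwitz :: "real^'n^'n \<Rightarrow> bool" where
  "hurwitz M \<longleftrightarrow> (\<forall>l. is_eigenvalue (complexify M) l \<longrightarrow> Re l < 0)"

definition stabilizable :: "real^'n^'n \<Rightarrow> real^'m^'n \<Rightarrow> bool" where
  "stabilizable A B \<longleftrightarrow> (\<exists>F::real^'n^'m. hurwitz (A - B ** F))"

definition symmetric :: "real^'n^'n \<Rightarrow> bool" where
  "symmetric M \<longleftrightarrow> transpose M = M"

definition positive_definite :: "real^'n^'n \<Rightarrow> bool" where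
  "positive_definite M \<longleftrightarrow> (\<forall>x. x \<noteq> 0 \<longrightarrow> 0 < x \<bullet> (M *v x))"

text \<open>The next two are meant for symmetric matrices, whose set of real eigenvalues is
  finite and nonempty, so that \<open>Min\<close> and \<open>Max\<close> are meaningful.\<close>

definition lambda_min :: "real^'n^'n \<Rightarrow> real" where
  "lambda_min M = Min {l. is_eigenvalue M l}"

definition lambda_max :: "real^'n^'n \<Rightarrow> real" where
  "lambda_max M = Max {l. is_eigenvalue M l}"

definition trigger ::
  "real^'m^'n \<Rightarrow> real^'n^'m \<Rightarrow> real^'n^'n \<Rightarrow> real \<Rightarrow> real^'n \<Rightarrow> real^'n \<Rightarrow> bool" where
  "trigger B K P \<sigma> x e \<longleftrightarrow>
     \<sigma> * (x \<bullet> (P *v x)) - 2 * (x \<bullet> ((P ** B ** K) *v e)) \<le> 0"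

text \<open>\<open>next_event B K P \<sigma> x \<tau> T\<close>: \<open>T\<close> is the first time strictly after the transmission
  instant \<open>\<tau>\<close> at which the triggering inequality holds for \<open>x\<close>, with \<open>T = \<infinity>\<close> if there is
  none. If \<open>x \<tau> = 0\<close>, then after the transmission the state, the held state and the error
  are all zero and remain so. The inequality then holds (as \<open>0 \<le> 0\<close>) at every later time,
  so that no first such time exists, while further transmissions would have no effect on
  the state; the convention is that none takes place.\<close>

definition next_event ::
  "real^'m^'n \<Rightarrow> real^'n^'m \<Rightarrow> real^'n^'n \<Rightarrow> real \<Rightarrow> (real \<Rightarrow> real^'n) \<Rightarrow> real \<Rightarrow> ereal \<Rightarrow> bool" where
  "next_event B K P \<sigma> x \<tau> T \<longleftrightarrow>
     ereal \<tau> < T \<and>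
     (if x \<tau> = 0 then T = \<infinity>
      else (\<forall>s. \<tau> < s \<and> ereal s < T \<longrightarrow> \<not> trigger B K P \<sigma> (x s) (x s - x \<tau>)) \<and>
           (\<forall>s. T = ereal s \<longrightarrow> trigger B K P \<sigma> (x s) (x s - x \<tau>)))"

text \<open>A trajectory consists of a state signal \<open>x\<close> and its transmission instants \<open>t\<close>; if
  there are only finitely many, the remaining \<open>t k\<close> are \<open>\<infinity>\<close>. It lives on
  \<open>[0, SUP k. t k)\<close>; values of \<open>x\<close> elsewhere are irrelevant. A finite supremum (accumulation
  of transmission instants) is not excluded here, but by \<open>globally_asymptotically_stable\<close>.
  The derivative at a transmission instant is the right derivative.\<close>

definition closed_loop_trajectory ::
  "real^'n^'n \<Rightarrow> real^'m^'n \<Rightarrow> real^'n^'m \<Rightarrow> real^'n^'n \<Rightarrow> real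
    \<Rightarrow> (nat \<Rightarrow> ereal) \<Rightarrow> (real \<Rightarrow> real^'n) \<Rightarrow> bool" where
  "closed_loop_trajectory A B K P \<sigma> t x \<longleftrightarrow>
     t 0 = 0 \<and>
     continuous_on {s. 0 \<le> s \<and> ereal s < (SUP k. t k)} x \<and>
     (\<forall>k. t k = \<infinity> \<longrightarrow> t (Suc k) = \<infinity>) \<and>
     (\<forall>k \<tau>. t k = ereal \<tau> \<longrightarrow>
        next_event B K P \<sigma> x \<tau> (t (Suc k)) \<and>
        (\<forall>s. \<tau> \<le> s \<and> ereal s < t (Suc k) \<longrightarrow>
           (x has_vector_derivative (A *v x s - (B ** K) *v x \<tau>)) (at s within {\<tau>..})))"

text \<open>\<open>traj t x\<close> says that \<open>x\<close>, with transmission instants \<open>t\<close>, is a trajectory of the system.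
  The first two conjuncts state that trajectories exist from every initial state and that all
  of them are defined on the whole of \<open>[0, \<infinity>)\<close>; the last two are Lyapunov stability and
  global attractivity of the origin.\<close>

definition globally_asymptotically_stable ::
  "((nat \<Rightarrow> ereal) \<Rightarrow> (real \<Rightarrow> 'v::real_normed_vector) \<Rightarrow> bool) \<Rightarrow> bool" where
  "globally_asymptotically_stable traj \<longleftrightarrow>
     (\<forall>x0. \<exists>t x. traj t x \<and> x 0 = x0) \<and>
     (\<forall>t x. traj t x \<longrightarrow> (SUP k. t k) = \<infinity>) \<and>
     (\<forall>\<epsilon>>0. \<exists>\<delta>>0. \<forall>t x. traj t x \<and> norm (x 0) < \<delta> \<longrightarrow> (\<forall>s\<ge>0. norm (x s) < \<epsilon>)) \<and>
     (\<forall>t x. traj t x \<longrightarrow> (x \<longlongrightarrow> 0) at_top)"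

end

theory Submission
  imports Defs
begin

text \<open>Take \<open>V x = x \<bullet> (P *v x)\<close>. As long as no event is triggered,
  \<open>V' = - (x \<bullet> (Q *v x)) + 2 * (x \<bullet> ((P ** B ** K) *v e)) < - (x \<bullet> (Q *v x)) + \<sigma> * V\<close>, and the
  Rayleigh bounds for \<open>P\<close> and \<open>Q\<close> turn this into \<open>V' \<le> - c * V\<close> with
  \<open>c = lambda_min Q / lambda_max P - \<sigma> > 0\<close>. The state is continuous across events, so
  \<open>V\<close> decays exponentially along the whole trajectory. Events cannot accumulate: by a
  Gronwall estimate the error stays below a fixed fraction of the held state for a uniform
  time, and during that time the term \<open>\<sigma> * V\<close> dominates. Trajectories are obtained by
  concatenating power series solutions of the affine equations with constant held state.\<close>

subsection \<open>Rayleigh bounds for symmetric matrices\<close>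

lemma uminus_matrix_vector:
  fixes M :: "real^'n^'m"
  shows "(- M) *v x = - (M *v x)"
  by (metis add.right_inverse add_eq_0_iff matrix_vector_mult_0 matrix_vector_mult_add_rdistrib)

lemma symmetric_inner_matrix_vector:
  fixes M :: "real^'n^'n"
  assumes "symmetric M"
  shows "x \<bullet> (M *v y) = (M *v x) \<bullet> y"
  using assms by (metis dot_lmul_matrix symmetric_def transpose_matrix_vector)

text \<open>Eigenvectors for distinct eigenvalues are orthogonal, so one choice per eigenvalue is an
  independent family, which the dimension bounds. Finiteness is what gives \<open>Min\<close> and
  \<open>Max\<close> in \<open>lambda_min\<close> and \<open>lambda_max\<close> their usual
  properties.\<close>

lemma finite_eigenvalues_symmetric:
  fixes M :: "real^'n^'n"
  assumes "symmetric M"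
  shows "finite {l. is_eigenvalue M l}"
proof -
  let ?E = "{l. is_eigenvalue M l}"
  have "\<forall>l\<in>?E. \<exists>v. v \<noteq> 0 \<and> M *v v = l *\<^sub>R v"
    by (simp add: is_eigenvalue_def scalar_mult_eq_scaleR)
  then obtain v where v: "\<And>l. l \<in> ?E \<Longrightarrow> v l \<noteq> 0 \<and> M *v v l = l *\<^sub>R v l"
    by metis
  have orth: "v l \<bullet> v m = 0" if "l \<in> ?E" "m \<in> ?E" "l \<noteq> m" for l m
  proof -
    have "m * (v l \<bullet> v m) = v l \<bullet> (M *v v m)"
      using v[OF that(2)] by simp
    also have "\<dots> = (M *v v l) \<bullet> v m"
      by (rule symmetric_inner_matrix_vector[OF assms])
    also have "\<dots> = l * (v l \<bullet> v m)"
      using v[OF that(1)] by simp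
    finally show ?thesis using that(3) by simp
  qed
  have inj: "inj_on v ?E"
    using orth v by (intro inj_onI) (metis inner_eq_zero_iff)
  have "pairwise orthogonal (v ` ?E)"
    using orth by (fastforce simp: pairwise_def orthogonal_def)
  moreover have "0 \<notin> v ` ?E" using v by force
  ultimately have "independent (v ` ?E)"
    by (rule pairwise_orthogonal_independent)
  then have "finite (v ` ?E)" using independent_bound by blast
  then show ?thesis using inj finite_imageD by blast
qed

text \<open>Compactness of the unit sphere yields a minimiser of the quadratic form. A variational
  argument shows that it is an eigenvector: if its residual were nonzero, a small move against the
  residual would go below the minimum.\<close>

lemma symmetric_rayleigh_minimum:
  fixes M :: "real^'n^'n"
  assumes "symmetric M"
  obtains l where "is_eigenvalue M l" and "\<And>x. l * (x \<bullet> x) \<le> x \<bullet> (M *v x)"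
proof -
  have cont: "continuous_on (sphere 0 1) (\<lambda>x. x \<bullet> (M *v x))"
    by (intro continuous_intros matrix_vector_mult_linear_continuous_on)
  obtain v :: "real^'n" where v: "v \<in> sphere 0 1"
    and vmin: "\<And>x. x \<in> sphere 0 1 \<Longrightarrow> v \<bullet> (M *v v) \<le> x \<bullet> (M *v x)"
    using continuous_attains_inf[OF compact_sphere _ cont] by fastforce
  define l where "l = v \<bullet> (M *v v)"
  \<comment> \<open>The quadratic form of M - l I: nonnegative everywhere by homogeneity, and zero
    at \<open>v\<close>.\<close>
  define q where "q x = x \<bullet> (M *v x) - l * (x \<bullet> x)" for x
  have q_nonneg: "0 \<le> q x" for x
  proof (cases "x = 0")
    case False
    define u where "u = (1 / norm x) *\<^sub>R x"
    have "u \<in> sphere 0 1" and x: "x = norm x *\<^sub>R u" using False by (auto simp: u_def)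
    then have "l \<le> u \<bullet> (M *v u)" using vmin l_def by blast
    moreover have "u \<bullet> u = 1" using \<open>u \<in> sphere 0 1\<close> by (simp add: norm_eq_1)
    then have "q x = (norm x)\<^sup>2 * (u \<bullet> (M *v u) - l)"
      unfolding q_def by (subst (1 2 3 4) x)
        (simp add: matrix_vector_mult_scaleR power2_eq_square algebra_simps)
    ultimately show ?thesis by simp
  qed (simp add: q_def)
  define r where "r = M *v v - l *\<^sub>R v"
  have vv: "v \<bullet> v = 1" using v by (simp add: norm_eq_1)
  have sym: "v \<bullet> (M *v r) = r \<bullet> (M *v v)"
    by (metis assms inner_commute symmetric_inner_matrix_vector)
  have rr: "r \<bullet> (M *v v) = r \<bullet> r + l * (r \<bullet> v)"
    by (simp add: r_def algebra_simps)
  have exp: "q (v - a *\<^sub>R r) = a\<^sup>2 * q r - 2 * a * (r \<bullet> r)" for a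
  proof -
    have "q (v - a *\<^sub>R r) = q v - a * (v \<bullet> (M *v r)) - a * (r \<bullet> (M *v v))
        + 2 * a * l * (r \<bullet> v) + a\<^sup>2 * q r"
      by (simp add: q_def matrix_vector_mult_scaleR matrix_vector_mult_diff_distrib
        inner_diff_left inner_diff_right inner_commute power2_eq_square algebra_simps)
    also have "q v = 0" by (simp add: q_def l_def vv)
    finally show ?thesis by (simp add: sym rr algebra_simps)
  qed
  \<comment> \<open>By \<open>exp\<close>, q along v - a r is a polynomial in a without constant
    term and with linear coefficient -2 (r . r). Nonnegativity kills that coefficient: test a = 1 if
    q r = 0, otherwise the vertex a = (r . r) / q r.\<close>
  have "r \<bullet> r = 0"
  proof (cases "q r = 0")
    case True
    then have "r \<bullet> r \<le> 0" using q_nonneg[of "v - 1 *\<^sub>R r"] exp[of 1] by simp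
    then show ?thesis using inner_ge_zero[of r] by linarith
  next
    case False
    then have pos: "0 < q r" using q_nonneg[of r] by simp
    have "q (v - ((r \<bullet> r) / q r) *\<^sub>R r) = - (r \<bullet> r)\<^sup>2 / q r"
      using pos by (simp add: exp power2_eq_square field_simps)
    then have "(r \<bullet> r)\<^sup>2 \<le> 0"
      using q_nonneg pos by (metis divide_minus_left neg_0_le_iff_le divide_le_0_iff not_less)
    then show ?thesis by simp
  qed
  then have "M *v v = l *s v" by (simp add: r_def scalar_mult_eq_scaleR)
  moreover have "v \<noteq> 0" using vv by auto
  ultimately have "is_eigenvalue M l" unfolding is_eigenvalue_def by blast
  then show ?thesis using that q_nonneg unfolding q_def by force
qed

lemma lambda_min_le_rayleigh:
  fixes M :: "real^'n^'n"
  assumes "symmetric M"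
  shows "lambda_min M * (x \<bullet> x) \<le> x \<bullet> (M *v x)"
proof -
  obtain l where l: "is_eigenvalue M l" and *: "\<And>x. l * (x \<bullet> x) \<le> x \<bullet> (M *v x)"
    using symmetric_rayleigh_minimum[OF assms] by blast
  have "lambda_min M \<le> l"
    unfolding lambda_min_def using l finite_eigenvalues_symmetric[OF assms] by (simp add: Min_le)
  then show ?thesis using *[of x] by (meson inner_ge_zero mult_right_mono order_trans)
qed

text \<open>The minimum principle applied to -M: a minimal eigenvalue l of -M is an eigenvalue -l of
  M.\<close>

lemma rayleigh_le_lambda_max:
  fixes M :: "real^'n^'n"
  assumes "symmetric M"
  shows "x \<bullet> (M *v x) \<le> lambda_max M * (x \<bullet> x)"
proof -
  have "symmetric (- M)"
    using assms by (simp add: symmetric_def transpose_def vec_eq_iff)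
  then obtain l where l: "is_eigenvalue (- M) l" and *: "\<And>x. l * (x \<bullet> x) \<le> x \<bullet> ((- M) *v x)"
    using symmetric_rayleigh_minimum by blast
  have "is_eigenvalue M (- l)"
    using l unfolding is_eigenvalue_def uminus_matrix_vector scalar_mult_eq_scaleR
    by (metis minus_equation_iff scaleR_minus_left)
  then have "- l \<le> lambda_max M"
    unfolding lambda_max_def using finite_eigenvalues_symmetric[OF assms] by (simp add: Max_ge)
  moreover have "x \<bullet> (M *v x) \<le> - l * (x \<bullet> x)" using *[of x] by (simp add: uminus_matrix_vector)
  ultimately show ?thesis by (meson inner_ge_zero mult_right_mono order_trans)
qed

lemma positive_definite_lower_bound:
  fixes M :: "real^'n^'n"
  assumes "symmetric M" and "positive_definite M"
  obtains p where "0 < p" and "\<And>x. p * (x \<bullet> x) \<le> x \<bullet> (M *v x)"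
proof -
  obtain l where l: "is_eigenvalue M l" and *: "\<And>x. l * (x \<bullet> x) \<le> x \<bullet> (M *v x)"
    using symmetric_rayleigh_minimum[OF assms(1)] by blast
  obtain v where v: "v \<noteq> 0" "M *v v = l *\<^sub>R v"
    using l unfolding is_eigenvalue_def scalar_mult_eq_scaleR by blast
  have "0 < l * (v \<bullet> v)" using assms(2) v unfolding positive_definite_def by fastforce
  then have "0 < l" using inner_ge_zero[of v] by (auto simp: zero_less_mult_iff)
  then show ?thesis using that * by blast
qed

subsection \<open>Affine differential equations\<close>

text \<open>Gronwall for the squared norm, which stays differentiable where e vanishes. Since 2 (e .
  w) <= |e|^2 + |w|^2, its derivative is at most (2L + 1) |e|^2 + |w|^2.\<close>

lemma forced_linear_ode_bound:
  fixes A :: "real^'n^'n" and e :: "real \<Rightarrow> real^'n"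
  assumes cont: "continuous_on {a..b} e"
    and deriv: "\<And>s. a < s \<Longrightarrow> s < b \<Longrightarrow> (e has_vector_derivative (A *v e s + w)) (at s)"
    and L: "\<And>z. norm (A *v z) \<le> L * norm z"
    and "e a = 0" and "a \<le> b"
  shows "(norm (e b))\<^sup>2 \<le> (norm w)\<^sup>2 * (b - a) * exp ((2 * L + 1) * (b - a))"
proof -
  define c where "c = 2 * L + 1"
  have "0 \<le> L"
    using L[of "axis undefined 1"] norm_ge_zero[of "A *v axis undefined 1"]
    by (simp del: norm_ge_zero)
  then have c: "0 \<le> c" by (simp add: c_def)
  \<comment> \<open>Integrating factor for the rate c; the subtracted linear term absorbs the
    forcing |w|^2, because the factor is at most 1 for s >= a.\<close>
  define g where "g s = exp (- c * (s - a)) * (e s \<bullet> e s) - (norm w)\<^sup>2 * (s - a)" for s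
  have "g b \<le> g a"
  proof (rule DERIV_nonpos_imp_decreasing_open[OF \<open>a \<le> b\<close>])
    show "continuous_on {a..b} g" unfolding g_def by (intro continuous_intros cont)
  next
    fix s assume s: "a < s" "s < b"
    let ?N = "e s \<bullet> e s"
    have "((\<lambda>s. e s \<bullet> e s) has_real_derivative 2 * (e s \<bullet> (A *v e s + w))) (at s)"
      using bounded_bilinear.has_vector_derivative[OF bounded_bilinear_inner
          deriv[OF s] deriv[OF s]]
      by (simp add: has_real_derivative_iff_has_vector_derivative inner_commute)
    then have dg: "(g has_real_derivative
        exp (- c * (s - a)) * (2 * (e s \<bullet> (A *v e s + w)) - c * ?N) - (norm w)\<^sup>2) (at s)"
      unfolding g_def by (auto intro!: derivative_eq_intros simp: algebra_simps)
    have "e s \<bullet> (A *v e s) \<le> norm (e s) * norm (A *v e s)" by (rule norm_cauchy_schwarz)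
    also have "\<dots> \<le> norm (e s) * (L * norm (e s))" by (intro mult_left_mono L) auto
    finally have 1: "e s \<bullet> (A *v e s) \<le> L * ?N"
      by (simp add: dot_square_norm power2_eq_square algebra_simps)
    have "2 * (e s \<bullet> w) \<le> ?N + w \<bullet> w"
      using inner_ge_zero[of "e s - w"] by (simp add: inner_diff_left inner_diff_right inner_commute)
    with 1 have 2: "2 * (e s \<bullet> (A *v e s + w)) - c * ?N \<le> (norm w)\<^sup>2"
      by (simp add: c_def inner_add_right algebra_simps flip: dot_square_norm)
    have "exp (- c * (s - a)) \<le> 1" using c s by simp
    then have "exp (- c * (s - a)) * (2 * (e s \<bullet> (A *v e s + w)) - c * ?N) \<le> (norm w)\<^sup>2"
      using 2 by (meson exp_ge_zero mult_left_mono mult_left_le_one_le order_trans zero_le_power2)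
    then show "\<exists>y. (g has_real_derivative y) (at s) \<and> y \<le> 0" using dg by fastforce
  qed
  then have "exp (- c * (b - a)) * (norm (e b))\<^sup>2 \<le> (norm w)\<^sup>2 * (b - a)"
    by (simp add: g_def \<open>e a = 0\<close> dot_square_norm)
  then have "exp (c * (b - a)) * (exp (- c * (b - a)) * (norm (e b))\<^sup>2)
      \<le> exp (c * (b - a)) * ((norm w)\<^sup>2 * (b - a))"
    by (intro mult_left_mono) auto
  also have "exp (c * (b - a)) * (exp (- c * (b - a)) * (norm (e b))\<^sup>2) = (norm (e b))\<^sup>2"
    by (simp add: mult.assoc[symmetric] flip: exp_add)
  finally show ?thesis by (simp add: c_def mult.commute)
qed

lemma affine_ode_solution_exists:
  fixes A :: "real^'n^'n" and x0 g :: "real^'n"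
  obtains y where "y 0 = x0"
    and "\<And>s. (y has_vector_derivative (A *v y s - g)) (at s)"
proof -
  \<comment> \<open>\<open>w\<close> is the initial velocity. As g is constant, the k-th derivative
    at 0 is A^(k-1) w for k >= 1, which dictates the Taylor coefficients \<open>d\<close>. The
    series converges for all times, so the solution is global.\<close>
  define w where "w = A *v x0 - g"
  define d where "d k = (case k of 0 \<Rightarrow> x0 | Suc j \<Rightarrow> (1 / fact k) *\<^sub>R (((*v) A) ^^ j) w)" for k
  define y where "y s = (\<chi> i. \<Sum>k. d k $ i * s ^ k)" for s
  obtain L where L: "0 < L" "\<And>z. norm (A *v z) \<le> norm z * L"
    using bounded_linear.pos_bounded[OF matrix_vector_mul_bounded_linear[of A]] by blast
  have iter: "norm ((((*v) A) ^^ j) w) \<le> L ^ j * norm w" for j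
  proof (induction j)
    case (Suc j)
    have "norm ((((*v) A) ^^ Suc j) w) \<le> norm ((((*v) A) ^^ j) w) * L"
      using L(2) by simp
    also have "\<dots> \<le> (L ^ j * norm w) * L" using Suc L(1) by (intro mult_right_mono) auto
    finally show ?case by (simp add: algebra_simps)
  qed simp
  have summ: "summable (\<lambda>k. d k $ i * s ^ k)" for i and s :: real
  proof -
    \<comment> \<open>The index is shifted because d 0 = x0 does not follow the pattern A^(k-1) w /
      k!; the shifted terms are dominated by an exponential series.\<close>
    have "summable (\<lambda>k. d (Suc k) $ i * s ^ Suc k)"
    proof (rule summable_comparison_test')
      show "summable (\<lambda>k. (norm w * \<bar>s\<bar>) * (inverse (fact k) * (L * \<bar>s\<bar>) ^ k))"
        by (intro summable_mult summable_exp)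
      fix k :: nat
      have "norm (d (Suc k) $ i) \<le> norm (d (Suc k))" by (rule Finite_Cartesian_Product.norm_nth_le)
      also have "\<dots> = (1 / fact (Suc k)) * norm ((((*v) A) ^^ k) w)"
        by (simp add: d_def)
      also have "\<dots> \<le> (1 / fact k) * (L ^ k * norm w)"
        by (intro mult_mono iter divide_left_mono fact_mono) auto
      finally have "norm (d (Suc k) $ i) * \<bar>s\<bar> ^ Suc k \<le> (1 / fact k) * (L ^ k * norm w) * \<bar>s\<bar> ^ Suc k"
        by (intro mult_right_mono) auto
      then show "norm (d (Suc k) $ i * s ^ Suc k)
          \<le> (norm w * \<bar>s\<bar>) * (inverse (fact k) * (L * \<bar>s\<bar>) ^ k)"
        by (simp add: abs_mult power_abs power_mult_distrib field_simps)
    qed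
    then show ?thesis by (subst summable_Suc_iff[symmetric])
  qed
  \<comment> \<open>The coefficient form of y' = A y - g: the constant g enters at index 0
    only.\<close>
  have diffs_d: "diffs (\<lambda>k. d k $ i) k = (A *v d k) $ i - (if k = 0 then g $ i else 0)" for i k
  proof (cases k)
    case 0
    then show ?thesis by (simp add: diffs_def d_def w_def)
  next
    case (Suc j)
    have "diffs (\<lambda>k. d k $ i) k = (of_nat (Suc k) / fact (Suc k)) * (A *v (((*v) A) ^^ j) w) $ i"
      by (simp add: diffs_def d_def Suc)
    also have "(of_nat (Suc k) / fact (Suc k) :: real) = 1 / fact k"
      by (simp add: divide_simps del: of_nat_Suc)
    finally show ?thesis by (simp add: d_def Suc matrix_vector_mult_scaleR)
  qed
  have sumA: "(\<lambda>k. (A *v d k) $ i * s ^ k) sums (A *v y s) $ i" for i s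
  proof -
    have "(\<lambda>k. \<Sum>j\<in>UNIV. A $ i $ j * (d k $ j * s ^ k)) sums (\<Sum>j\<in>UNIV. A $ i $ j * y s $ j)"
      unfolding y_def by (intro sums_sum sums_mult) (simp add: summable_sums summ)
    then show ?thesis
      by (simp add: matrix_vector_mult_def sum_distrib_right mult.assoc)
  qed
  have "(\<Sum>k. diffs (\<lambda>k. d k $ i) k * s ^ k) = (A *v y s - g) $ i" for i s
  proof -
    have "(\<lambda>k. (if k = 0 then g $ i else 0) * s ^ k) sums (g $ i)"
      using sums_single[of 0 "\<lambda>k. g $ i * s ^ k"] by (simp add: if_distrib[of "\<lambda>x. x * _"] cong: if_cong)
    from sums_diff[OF sumA this] show ?thesis
      by (simp add: diffs_d left_diff_distrib sums_iff)
  qed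
  then have comp: "((\<lambda>s. y s $ i) has_real_derivative (A *v y s - g) $ i) (at s)" for i s
    using termdiffs_strong_converges_everywhere[OF summ, of i s] by (simp add: y_def)
  have "(y has_vector_derivative (A *v y s - g)) (at s)" for s
    unfolding has_vector_derivative_def
    by (subst has_derivative_componentwise_within)
      (use comp[unfolded has_real_derivative_iff_has_vector_derivative has_vector_derivative_def] in
        \<open>auto simp: Basis_vec_def inner_axis\<close>)
  moreover have "y 0 = x0"
    by (simp add: y_def d_def vec_eq_iff powser_zero)
  ultimately show ?thesis using that by blast
qed

subsection \<open>The event-triggered loop\<close>

text \<open>Replaces Q and the Lyapunov equation by their consequence \<open>decrease\<close>: with
  held state x - e and no event, the derivative of V is at most -c V.\<close>

locale lyapunov_event_loop =
  fixes A :: "real^'n^'n" and B :: "real^'m^'n" and K :: "real^'n^'m"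
    and P :: "real^'n^'n" and \<sigma> p c :: real
  assumes symP: "symmetric P"
    and p_pos: "0 < p" and p_bound: "\<And>x. p * (x \<bullet> x) \<le> x \<bullet> (P *v x)"
    and sigma_pos: "0 < \<sigma>" and c_pos: "0 < c"
    and decrease: "\<And>x e. \<not> trigger B K P \<sigma> x e \<Longrightarrow>
      2 * (x \<bullet> (P *v (A *v x - (B ** K) *v (x - e)))) \<le> - c * (x \<bullet> (P *v x))"
begin

text \<open>One segment between transmissions, with \<open>x a\<close> as held state. The equation
  is required only in the open interval, so \<open>b\<close> may be the next event, where the
  trajectory can have a kink.\<close>

definition "held_solution x a b \<longleftrightarrow> a \<le> b \<and> continuous_on {a..b} x \<and>
  (\<forall>s. a < s \<and> s < b \<longrightarrow>
    (x has_vector_derivative (A *v x s - (B ** K) *v x a)) (at s))"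

lemma held_solution_error_bound:
  assumes "held_solution x a b" and L: "\<And>z. norm (A *v z) \<le> L * norm z"
  shows "(norm (x b - x a))\<^sup>2
    \<le> (norm ((A - B ** K) *v x a))\<^sup>2 * (b - a) * exp ((2 * L + 1) * (b - a))"
proof (rule forced_linear_ode_bound[where e = "\<lambda>s. x s - x a" and A = A])
  show "a \<le> b" "continuous_on {a..b} (\<lambda>s. x s - x a)"
    using assms(1) unfolding held_solution_def by (auto intro!: continuous_intros)
next
  fix s assume "a < s" "s < b"
  then have "(x has_vector_derivative (A *v x s - (B ** K) *v x a)) (at s)"
    using assms(1) unfolding held_solution_def by blast
  then have "((\<lambda>s. x s - x a) has_vector_derivative (A *v x s - (B ** K) *v x a)) (at s)"
    by (simp add: has_vector_derivative_diff_const)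
  then show "((\<lambda>s. x s - x a) has_vector_derivative
      (A *v (x s - x a) + (A - B ** K) *v x a)) (at s)"
    by (simp add: algebra_simps)
qed (use L in auto)

lemma held_solution_zero:
  assumes "held_solution x a b" and "x a = 0"
  shows "x b = 0"
proof -
  obtain L where "\<And>z. norm (A *v z) \<le> norm z * L"
    using bounded_linear.pos_bounded[OF matrix_vector_mul_bounded_linear[of A]] by blast
  then have "\<And>z. norm (A *v z) \<le> L * norm z" by (simp add: mult.commute)
  from held_solution_error_bound[OF assms(1) this] show ?thesis by (simp add: assms(2))
qed

text \<open>The error obeys a linear equation driven by the held state, so it grows from zero at a
  rate proportional to the norm of that state; the event condition is homogeneous, which makes
  the delay uniform.\<close>

lemma dwell_time:
  obtains h where "0 < h"
    and "\<And>x a b. held_solution x a b \<Longrightarrow> x a \<noteq> 0 \<Longrightarrow> b < a + h \<Longrightarrow>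
      \<not> trigger B K P \<sigma> (x b) (x b - x a)"
proof -
  obtain L where L: "0 < L" "\<And>z. norm (A *v z) \<le> norm z * L"
    using bounded_linear.pos_bounded[OF matrix_vector_mul_bounded_linear[of A]] by blast
  obtain M where M: "0 < M" "\<And>z. norm ((A - B ** K) *v z) \<le> norm z * M"
    using bounded_linear.pos_bounded[OF matrix_vector_mul_bounded_linear[of "A - B ** K"]] by blast
  obtain C where C: "0 < C" "\<And>z. norm ((P ** B ** K) *v z) \<le> norm z * C"
    using bounded_linear.pos_bounded[OF matrix_vector_mul_bounded_linear[of "P ** B ** K"]] by blast
  \<comment> \<open>A threshold for |e| / |x a|, chosen so that 2 C r < sigma p (1 - r). If |e| <= r
    |x a|, then |x b| >= (1 - r) |x a|, and the term sigma V beats the cross term.\<close>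
  define r where "r = \<sigma> * p / (2 * (\<sigma> * p + 2 * C))"
  have sp: "0 < \<sigma> * p" using sigma_pos p_pos by simp
  have r: "0 < r" "r < 1" using sp C(1) by (auto simp: r_def field_simps)
  have r_less: "2 * C * r < \<sigma> * p * (1 - r)"
  proof -
    have "r * (\<sigma> * p + 2 * C) = \<sigma> * p / 2" using sp C(1) by (simp add: r_def field_simps)
    then show ?thesis using sp by (simp add: algebra_simps)
  qed
  define E where "E = M\<^sup>2 * exp (2 * L + 1)"
  have E: "0 < E" using M(1) by (simp add: E_def)
  \<comment> \<open>The bound 1 keeps the Gronwall exponent uniform, as absorbed in
    \<open>E\<close>; the bound r^2 / E then gives |e| <= r |x a|.\<close>
  define h where "h = min 1 (r\<^sup>2 / E)"
  have "0 < h" using r E by (simp add: h_def)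
  moreover have "\<not> trigger B K P \<sigma> (x b) (x b - x a)"
    if sol: "held_solution x a b" and nz: "x a \<noteq> 0" and bh: "b < a + h" for x a b
  proof
    assume trig: "trigger B K P \<sigma> (x b) (x b - x a)"
    define e where "e = x b - x a"
    have ab: "0 \<le> b - a" "b - a \<le> 1" and "b - a \<le> r\<^sup>2 / E"
      using sol bh by (auto simp: held_solution_def h_def)
    then have abE: "(b - a) * E \<le> r\<^sup>2" using E by (simp add: pos_le_divide_eq)
    have "(norm e)\<^sup>2 \<le> (norm ((A - B ** K) *v x a))\<^sup>2 * (b - a) * exp ((2 * L + 1) * (b - a))"
      unfolding e_def using held_solution_error_bound[OF sol] L(2) by (simp add: mult.commute)
    also have "\<dots> \<le> (norm (x a) * M)\<^sup>2 * (b - a) * exp ((2 * L + 1) * 1)"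
      using ab L(1) by (intro mult_mono power_mono M(2)) auto
    also have "\<dots> = (norm (x a))\<^sup>2 * ((b - a) * E)"
      by (simp add: E_def power_mult_distrib algebra_simps)
    also have "\<dots> \<le> (norm (x a))\<^sup>2 * r\<^sup>2" using abE by (intro mult_left_mono) auto
    finally have "(norm e)\<^sup>2 \<le> (r * norm (x a))\<^sup>2" by (simp add: power_mult_distrib mult.commute)
    then have e_le: "norm e \<le> r * norm (x a)"
      using r(1) by (auto intro: power2_le_imp_le)
    have "norm (x a) \<le> norm (x b) + norm e"
      unfolding e_def using norm_triangle_ineq4[of "x b" "x b - x a"] by simp
    with e_le have xb_ge: "(1 - r) * norm (x a) \<le> norm (x b)" by (simp add: algebra_simps)
    moreover have "0 < (1 - r) * norm (x a)" using r nz by simp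
    ultimately have xb_pos: "0 < norm (x b)" by linarith
    have "\<sigma> * p * (norm (x b) * norm (x b)) \<le> \<sigma> * (x b \<bullet> (P *v x b))"
      using p_bound[of "x b"] sigma_pos by (simp add: dot_square_norm power2_eq_square)
    also have "\<dots> \<le> 2 * (x b \<bullet> ((P ** B ** K) *v e))"
      using trig by (simp add: trigger_def e_def)
    also have "\<dots> \<le> 2 * (norm (x b) * norm ((P ** B ** K) *v e))"
      by (simp add: norm_cauchy_schwarz)
    also have "\<dots> \<le> 2 * (norm (x b) * (norm e * C))"
      using C(2)[of e] by (simp add: mult_left_mono)
    finally have "norm (x b) * (\<sigma> * p * norm (x b)) \<le> norm (x b) * (2 * C * norm e)"
      by (simp add: algebra_simps)
    then have "\<sigma> * p * norm (x b) \<le> 2 * C * norm e" using xb_pos by simp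
    also have "\<dots> \<le> 2 * C * (r * norm (x a))" using e_le C(1) by simp
    finally have "\<sigma> * p * norm (x b) \<le> 2 * C * r * norm (x a)" by simp
    moreover have "\<sigma> * p * ((1 - r) * norm (x a)) \<le> \<sigma> * p * norm (x b)"
      using xb_ge sp by (intro mult_left_mono) auto
    moreover have "2 * C * r * norm (x a) < \<sigma> * p * (1 - r) * norm (x a)"
      using r_less nz by simp
    ultimately show False by (simp add: mult.assoc)
  qed
  ultimately show ?thesis using that by blast
qed

text \<open>The derivative of exp (c s) V is exp (c s) (c V + V'), and \<open>decrease\<close> with
  e = x s - x a makes it nonpositive.\<close>

lemma lyapunov_decay:
  assumes sol: "held_solution x a b"
    and no_event: "\<And>s. a < s \<Longrightarrow> s < b \<Longrightarrow> \<not> trigger B K P \<sigma> (x s) (x s - x a)"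
  shows "exp (c * b) * (x b \<bullet> (P *v x b)) \<le> exp (c * a) * (x a \<bullet> (P *v x a))"
proof (rule DERIV_nonpos_imp_decreasing_open
      [where f = "\<lambda>s. exp (c * s) * (x s \<bullet> (P *v x s))"])
  show "a \<le> b" using sol by (simp add: held_solution_def)
  have "continuous_on {a..b} x" using sol by (simp add: held_solution_def)
  then show "continuous_on {a..b} (\<lambda>s. exp (c * s) * (x s \<bullet> (P *v x s)))"
    by (intro continuous_intros
        continuous_on_compose2[OF matrix_vector_mult_linear_continuous_on[of UNIV P]]) auto
next
  fix s assume s: "a < s" "s < b"
  let ?dx = "A *v x s - (B ** K) *v x a"
  have dx: "(x has_vector_derivative ?dx) (at s)"
    using sol s by (simp add: held_solution_def)
  have dPx: "((\<lambda>s. P *v x s) has_vector_derivative (P *v ?dx)) (at s)"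
    by (rule bounded_linear.has_vector_derivative[OF matrix_vector_mul_bounded_linear dx])
  have "((\<lambda>s. x s \<bullet> (P *v x s)) has_real_derivative (x s \<bullet> (P *v ?dx) + ?dx \<bullet> (P *v x s))) (at s)"
    using bounded_bilinear.has_vector_derivative[OF bounded_bilinear_inner dx dPx]
    by (simp add: has_real_derivative_iff_has_vector_derivative)
  also have "?dx \<bullet> (P *v x s) = x s \<bullet> (P *v ?dx)"
    by (metis inner_commute symP symmetric_inner_matrix_vector)
  finally have dV: "((\<lambda>s. x s \<bullet> (P *v x s)) has_real_derivative 2 * (x s \<bullet> (P *v ?dx))) (at s)"
    by simp
  have "((\<lambda>s. exp (c * s) * (x s \<bullet> (P *v x s))) has_real_derivative
      exp (c * s) * (c * (x s \<bullet> (P *v x s)) + 2 * (x s \<bullet> (P *v ?dx)))) (at s)"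
    by (auto intro!: derivative_eq_intros dV simp: algebra_simps)
  moreover have "2 * (x s \<bullet> (P *v ?dx)) \<le> - c * (x s \<bullet> (P *v x s))"
    using decrease[OF no_event[OF s]] by simp
  then have "exp (c * s) * (c * (x s \<bullet> (P *v x s)) + 2 * (x s \<bullet> (P *v ?dx))) \<le> 0"
    by (simp add: mult_le_0_iff)
  ultimately show "\<exists>y. ((\<lambda>s. exp (c * s) * (x s \<bullet> (P *v x s))) has_real_derivative y) (at s) \<and> y \<le> 0"
    by blast
qed

section \<open>Properties of an arbitrary trajectory: completeness and decay\<close>

context
  fixes t :: "nat \<Rightarrow> ereal" and x :: "real \<Rightarrow> real^'n"
  assumes traj: "closed_loop_trajectory A B K P \<sigma> t x"
begin

lemma instants_mono: "t k \<le> t (Suc k)"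
proof (cases "t k")
  case (real r)
  then show ?thesis
    using traj unfolding closed_loop_trajectory_def next_event_def by (metis less_imp_le)
qed (use traj in \<open>auto simp: closed_loop_trajectory_def\<close>)

lemma instants_nonneg: "0 \<le> t k"
proof -
  have "incseq t" using instants_mono by (rule incseq_SucI)
  then have "t 0 \<le> t k" by (simp add: incseqD)
  then show ?thesis using traj by (simp add: closed_loop_trajectory_def)
qed

lemma instants_next_event: "t k = ereal a \<Longrightarrow> next_event B K P \<sigma> x a (t (Suc k))"
  using traj by (simp add: closed_loop_trajectory_def)

lemma trajectory_held_solution:
  assumes tk: "t k = ereal a" and "a \<le> b" and b: "ereal b \<le> t (Suc k)"
  shows "held_solution x a b"
proof -
  \<comment> \<open>Continuity is known only strictly below the supremum. If \<open>b\<close> is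
    itself the next instant, the instant after it is strictly later and supplies the room.\<close>
  have b_sup: "ereal b < (SUP k. t k)"
  proof (cases "ereal b < t (Suc k)")
    case True
    then show ?thesis by (meson SUP_upper UNIV_I less_le_trans)
  next
    case False
    then have "t (Suc k) = ereal b" using b by simp
    then have "ereal b < t (Suc (Suc k))" using instants_next_event next_event_def by blast
    then show ?thesis by (meson SUP_upper UNIV_I less_le_trans)
  qed
  have a: "0 \<le> a" using instants_nonneg[of k] tk by simp
  have "{a..b} \<subseteq> {s. 0 \<le> s \<and> ereal s < (SUP k. t k)}"
    using a b_sup by (auto intro: le_less_trans[of _ "ereal b"])
  then have "continuous_on {a..b} x"
    using traj unfolding closed_loop_trajectory_def by (meson continuous_on_subset)
  moreover have "(x has_vector_derivative (A *v x s - (B ** K) *v x a)) (at s)"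
    if s: "a < s" "s < b" for s
  proof -
    have "ereal s < t (Suc k)" using s b by (metis ereal_less(1) less_ereal.simps(1) less_le_trans)
    then have "(x has_vector_derivative (A *v x s - (B ** K) *v x a)) (at s within {a..})"
      using traj tk s unfolding closed_loop_trajectory_def by simp
    moreover have "at s within {a..} = at s"
      using s by (intro at_within_interior) (simp add: interior_real_atLeast)
    ultimately show ?thesis by simp
  qed
  ultimately show ?thesis using \<open>a \<le> b\<close> by (simp add: held_solution_def)
qed

text \<open>Either some instant is infinite, or all are finite and successive ones are at least the
  dwell time h apart, so that t k >= k h is unbounded.\<close>

lemma trajectory_complete: "(SUP k. t k) = \<infinity>"
proof (cases "\<exists>k. t k = \<infinity>")
  case True
  then obtain k where "t k = \<infinity>" by blast
  then show ?thesis using SUP_upper[of k UNIV t] by simp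
next
  case False
  obtain h where h: "0 < h" "\<And>x a b. held_solution x a b \<Longrightarrow> x a \<noteq> 0 \<Longrightarrow> b < a + h \<Longrightarrow>
      \<not> trigger B K P \<sigma> (x b) (x b - x a)"
    using dwell_time by blast
  define \<tau> where "\<tau> k = real_of_ereal (t k)" for k
  have \<tau>: "t k = ereal (\<tau> k)" for k
    using False instants_nonneg[of k] by (cases "t k") (auto simp: \<tau>_def)
  have gap: "\<tau> k + h \<le> \<tau> (Suc k)" for k
  proof (rule ccontr)
    assume less: "\<not> \<tau> k + h \<le> \<tau> (Suc k)"
    have ev: "next_event B K P \<sigma> x (\<tau> k) (ereal (\<tau> (Suc k)))"
      using instants_next_event \<tau> by metis
    \<comment> \<open>From a zero state \<open>next_event\<close> allows only an infinite next
      instant, and this one is finite.\<close>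
    then have "x (\<tau> k) \<noteq> 0" by (auto simp: next_event_def)
    with ev have "trigger B K P \<sigma> (x (\<tau> (Suc k))) (x (\<tau> (Suc k)) - x (\<tau> k))"
      by (simp add: next_event_def)
    moreover have "held_solution x (\<tau> k) (\<tau> (Suc k))"
      using trajectory_held_solution[OF \<tau>] instants_mono[of k] by (simp add: \<tau>)
    ultimately show False using h(2) \<open>x (\<tau> k) \<noteq> 0\<close> less by force
  qed
  have lower: "real k * h \<le> \<tau> k" for k
  proof (induction k)
    case 0
    then show ?case using instants_nonneg[of 0] by (simp add: \<tau>)
  next
    case (Suc k)
    then show ?case using gap[of k] by (simp add: algebra_simps)
  qed
  show ?thesis
  proof (rule SUP_PInfty)
    fix n :: nat
    obtain k where "real n < real k * h" using reals_Archimedean3[OF h(1)] by blast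
    then have "ereal (real n) \<le> t k" using lower[of k] by (simp add: \<tau>)
    then show "\<exists>k\<in>UNIV. ereal (real n) \<le> t k" by blast
  qed
qed

text \<open>A zero held state is treated apart: the triggering inequality then holds as 0 <= 0, so
  \<open>lyapunov_decay\<close> does not apply, but the state simply stays zero.\<close>

lemma trajectory_decay_step:
  assumes tk: "t k = ereal a" and "a \<le> b" and b: "ereal b \<le> t (Suc k)"
  shows "exp (c * b) * (x b \<bullet> (P *v x b)) \<le> exp (c * a) * (x a \<bullet> (P *v x a))"
proof (cases "x a = 0")
  case True
  then show ?thesis using held_solution_zero[OF trajectory_held_solution[OF assms]] by simp
next
  case False
  show ?thesis
  proof (rule lyapunov_decay[OF trajectory_held_solution[OF assms]])
    fix s assume s: "a < s" "s < b"
    then have "ereal s < t (Suc k)" using b by (meson less_ereal.simps(1) less_le_trans)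
    then show "\<not> trigger B K P \<sigma> (x s) (x s - x a)"
      using instants_next_event[OF tk] False s by (simp add: next_event_def)
  qed
qed

lemma instants_decay:
  "t k = ereal a \<Longrightarrow> exp (c * a) * (x a \<bullet> (P *v x a)) \<le> x 0 \<bullet> (P *v x 0)"
proof (induction k arbitrary: a)
  case 0
  then have "a = 0" using traj by (simp add: closed_loop_trajectory_def zero_ereal_def)
  then show ?case by simp
next
  case (Suc k)
  then have "t k \<noteq> \<infinity>" using traj by (auto simp: closed_loop_trajectory_def)
  then obtain a' where a': "t k = ereal a'"
    using instants_nonneg[of k] by (cases "t k") auto
  have "a' \<le> a" using instants_mono[of k] Suc.prems a' by simp
  from trajectory_decay_step[OF a' this] Suc.IH[OF a'] show ?case
    by (simp add: Suc.prems)
qed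

lemma trajectory_decay:
  assumes "0 \<le> s"
  shows "exp (c * s) * (x s \<bullet> (P *v x s)) \<le> x 0 \<bullet> (P *v x 0)"
proof -
  have "ereal s < (SUP k. t k)" by (simp add: trajectory_complete)
  then have ex: "\<exists>k. ereal s < t k" by (simp add: less_SUP_iff)
  \<comment> \<open>The predecessor of the first instant after \<open>s\<close> starts the segment
    containing \<open>s\<close>; such an instant exists by completeness.\<close>
  define n where "n = (LEAST k. ereal s < t k)"
  have n: "ereal s < t n" unfolding n_def using ex by (rule LeastI_ex)
  have "t 0 = 0" using traj by (simp add: closed_loop_trajectory_def)
  then have "n \<noteq> 0" using n assms by (cases n) (auto simp: zero_ereal_def)
  then obtain k where k: "n = Suc k" using not0_implies_Suc by blast
  have "t k \<le> ereal s" using not_less_Least[of k "\<lambda>k. ereal s < t k"] k n_def by simp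
  then obtain a where a: "t k = ereal a" "a \<le> s"
    using instants_nonneg[of k] by (cases "t k") auto
  show ?thesis
    using trajectory_decay_step[OF a] instants_decay[OF a(1)] n k by fastforce
qed

end

subsection \<open>Existence of trajectories\<close>

text \<open>Here \<open>y\<close> is both initial and held state. The dynamics are time invariant,
  so this one family, shifted in time, supplies every segment.\<close>

definition "flow y = (SOME \<phi>. \<phi> 0 = y \<and>
  (\<forall>s. (\<phi> has_vector_derivative (A *v \<phi> s - (B ** K) *v y)) (at s)))"

lemma flow_0 [simp]: "flow y 0 = y"
  and flow_derivative:
    "(flow y has_vector_derivative (A *v flow y s - (B ** K) *v y)) (at s within S)"
proof -
  have "\<exists>\<phi>. \<phi> 0 = y \<and>
      (\<forall>s. (\<phi> has_vector_derivative (A *v \<phi> s - (B ** K) *v y)) (at s))"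
    using affine_ode_solution_exists by metis
  then have *: "flow y 0 = y \<and>
      (\<forall>s. (flow y has_vector_derivative (A *v flow y s - (B ** K) *v y)) (at s))"
    unfolding flow_def by (rule someI_ex)
  then show "flow y 0 = y" by blast
  show "(flow y has_vector_derivative (A *v flow y s - (B ** K) *v y)) (at s within S)"
    using * has_vector_derivative_at_within by blast
qed

lemma continuous_on_flow: "continuous_on S (flow y)"
  unfolding continuous_on_eq_continuous_within
  using flow_derivative has_vector_derivative_continuous by blast

text \<open>A first triggering time exists if the set of triggering times is closed. Strict
  positivity is not a closed condition, but the dwell time permits replacing s > 0 by s >=
  h.\<close>

lemma next_event_flow_exists: "\<exists>T. next_event B K P \<sigma> (flow y) 0 T"
proof -
  define S where "S = {s. 0 < s \<and> trigger B K P \<sigma> (flow y s) (flow y s - y)}"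
  consider "y = 0" | "y \<noteq> 0" "S = {}" | "y \<noteq> 0" "S \<noteq> {}" by blast
  then show ?thesis
  proof cases
    case 1
    then have "next_event B K P \<sigma> (flow y) 0 \<infinity>" by (simp add: next_event_def)
    then show ?thesis by blast
  next
    case 2
    then have "next_event B K P \<sigma> (flow y) 0 \<infinity>" by (auto simp: next_event_def S_def)
    then show ?thesis by blast
  next
    case 3
    obtain h where h: "0 < h" "\<And>x a b. held_solution x a b \<Longrightarrow> x a \<noteq> 0 \<Longrightarrow> b < a + h \<Longrightarrow>
        \<not> trigger B K P \<sigma> (x b) (x b - x a)"
      using dwell_time by blast
    have "held_solution (flow y) 0 s" if "0 < s" for s
      using that by (simp add: held_solution_def continuous_on_flow flow_derivative)
    then have ge: "h \<le> s" if "s \<in> S" for s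
      using h(2)[of "flow y" 0 s] that 3(1) by (force simp: S_def)
    then have S_eq: "S = {h..} \<inter>
        {s. \<sigma> * (flow y s \<bullet> (P *v flow y s)) - 2 * (flow y s \<bullet> ((P ** B ** K) *v (flow y s - y))) \<le> 0}"
      using h(1) by (force simp: S_def trigger_def)
    have "closed S"
      unfolding S_eq
      by (intro closed_Int closed_atLeast closed_Collect_le continuous_intros continuous_on_flow
          continuous_on_compose2[OF matrix_vector_mult_linear_continuous_on[of UNIV]]) auto
    moreover have bdd: "bdd_below S" using ge by (auto simp: bdd_below_def)
    ultimately have "Inf S \<in> S" using 3(2) by (simp add: closed_contains_Inf)
    moreover have "s \<notin> S" if "s < Inf S" for s using cInf_lower[OF _ bdd] that by force
    ultimately have "next_event B K P \<sigma> (flow y) 0 (ereal (Inf S))"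
      using 3(1) by (auto simp: next_event_def S_def)
    then show ?thesis by blast
  qed
qed

definition "event_delay y = (SOME T. next_event B K P \<sigma> (flow y) 0 T)"

lemma next_event_event_delay: "next_event B K P \<sigma> (flow y) 0 (event_delay y)"
  unfolding event_delay_def by (rule someI_ex[OF next_event_flow_exists])

lemma event_delay_pos: "0 < event_delay y"
  using next_event_event_delay[of y] by (simp add: next_event_def zero_ereal_def)

text \<open>After an infinite delay \<open>real_of_ereal\<close> returns 0, so the held state is
  merely repeated while the instants stay infinite.\<close>

primrec event_sequence :: "real^'n \<Rightarrow> nat \<Rightarrow> ereal \<times> (real^'n)" where
  "event_sequence x0 0 = (0, x0)"
| "event_sequence x0 (Suc k) =
    (let (a, y) = event_sequence x0 k
     in (a + event_delay y, flow y (real_of_ereal (event_delay y))))"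

definition "instant x0 k = fst (event_sequence x0 k)"
definition "held x0 k = snd (event_sequence x0 k)"

text \<open>\<open>LEAST\<close> selects the segment containing s, with an event time assigned to
  the segment it starts. Times not below the supremum of the instants get an irrelevant
  value.\<close>

definition "state x0 s = (let k = (LEAST k. ereal s < instant x0 (Suc k))
  in flow (held x0 k) (s - real_of_ereal (instant x0 k)))"

lemma instant_0 [simp]: "instant x0 0 = 0"
  and held_0 [simp]: "held x0 0 = x0"
  and instant_Suc: "instant x0 (Suc k) = instant x0 k + event_delay (held x0 k)"
  and held_Suc: "held x0 (Suc k) = flow (held x0 k) (real_of_ereal (event_delay (held x0 k)))"
  by (simp_all add: instant_def held_def case_prod_beta Let_def)

lemma instant_nonneg: "0 \<le> instant x0 k"
  by (induction k) (simp_all add: instant_Suc event_delay_pos less_imp_le)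

lemma instant_mono: "incseq (instant x0)"
proof (rule incseq_SucI)
  fix k
  show "instant x0 k \<le> instant x0 (Suc k)"
    using add_left_mono[of 0 "event_delay (held x0 k)" "instant x0 k"]
    by (simp add: instant_Suc event_delay_pos less_imp_le)
qed

lemma instant_less_Suc:
  assumes "instant x0 k = ereal a"
  shows "ereal a < instant x0 (Suc k)"
  using assms event_delay_pos[of "held x0 k"]
  by (cases "event_delay (held x0 k)") (auto simp: instant_Suc zero_ereal_def)

lemma state_eq_flow:
  assumes k: "instant x0 k = ereal a" and "a \<le> s" and s: "ereal s \<le> instant x0 (Suc k)"
  shows "state x0 s = flow (held x0 k) (s - a)"
proof -
  have *: "state x0 s = flow (held x0 k) (s - a)"
    if k: "instant x0 k = ereal a" and "a \<le> s" and s: "ereal s < instant x0 (Suc k)" for k a s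
  proof -
    have "(LEAST k. ereal s < instant x0 (Suc k)) = k"
    proof (rule Least_equality)
      show "ereal s < instant x0 (Suc k)" by (rule s)
    next
      fix j assume j: "ereal s < instant x0 (Suc j)"
      show "k \<le> j"
      proof (rule ccontr)
        assume "\<not> k \<le> j"
        then have "instant x0 (Suc j) \<le> instant x0 k" by (intro incseqD[OF instant_mono]) simp
        then have "instant x0 (Suc j) \<le> ereal s" using k \<open>a \<le> s\<close> by (simp add: order_trans)
        then show False using j by simp
      qed
    qed
    then show ?thesis by (simp add: state_def k)
  qed
  show ?thesis
  proof (cases "ereal s < instant x0 (Suc k)")
    case True
    then show ?thesis using * assms by blast
  next
    \<comment> \<open>At the right endpoint \<open>state\<close> already uses the next segment,
      whose initial value \<open>held_Suc\<close> is the end value of this flow. This agreement is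
      the continuity across events.\<close>
    case False
    then have eq: "instant x0 (Suc k) = ereal s" using s by simp
    then have "event_delay (held x0 k) = ereal (s - a)"
      using k by (cases "event_delay (held x0 k)") (auto simp: instant_Suc)
    then have "held x0 (Suc k) = flow (held x0 k) (s - a)" by (simp add: held_Suc)
    then show ?thesis using *[OF eq _ instant_less_Suc[OF eq]] by simp
  qed
qed

lemma state_instant:
  assumes "instant x0 k = ereal a"
  shows "state x0 a = held x0 k"
  using state_eq_flow[OF assms order_refl less_imp_le[OF instant_less_Suc[OF assms]]] by simp

lemma state_0: "state x0 0 = x0"
  using state_instant[of x0 0 0] by (simp add: zero_ereal_def)

lemma continuous_on_state_segment:
  assumes "0 \<le> b" and "ereal b \<le> instant x0 k"
  shows "continuous_on {0..b} (state x0)"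
  using assms
proof (induction k arbitrary: b)
  case 0
  then have "b = 0" by (simp add: zero_ereal_def)
  then show ?case by simp
next
  case (Suc k)
  show ?case
  proof (cases "ereal b \<le> instant x0 k")
    case True
    then show ?thesis using Suc by blast
  next
    case False
    then obtain a where a: "instant x0 k = ereal a" "a < b"
      using instant_nonneg[of x0 k] by (cases "instant x0 k") auto
    have "0 \<le> a" using a(1) instant_nonneg[of x0 k] by simp
    have "continuous_on {0..a} (state x0)" using Suc.IH[OF \<open>0 \<le> a\<close>] a by simp
    moreover have "continuous_on {a..b} (state x0)"
    proof (rule continuous_on_eq)
      show "continuous_on {a..b} (\<lambda>s. flow (held x0 k) (s - a))"
        by (intro continuous_on_compose2[OF continuous_on_flow[of UNIV]] continuous_intros) auto
      fix s assume s: "s \<in> {a..b}"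
      then have "ereal s \<le> instant x0 (Suc k)"
        using Suc.prems(2) by (auto intro: order_trans[of _ "ereal b"])
      then show "flow (held x0 k) (s - a) = state x0 s"
        using state_eq_flow[OF a(1)] s by simp
    qed
    ultimately have "continuous_on ({0..a} \<union> {a..b}) (state x0)"
      by (intro continuous_on_closed_Un) auto
    moreover have "{0..a} \<union> {a..b} = {0..b}" using a \<open>0 \<le> a\<close> by auto
    ultimately show ?thesis by simp
  qed
qed

lemma continuous_on_state:
  "continuous_on {s. 0 \<le> s \<and> ereal s < (SUP k. instant x0 k)} (state x0)"
  unfolding continuous_on_eq_continuous_within
proof
  let ?S = "{s. 0 \<le> s \<and> ereal s < (SUP k. instant x0 k)}"
  fix s assume s: "s \<in> ?S"
  then obtain k where "ereal s < instant x0 k" by (auto simp: less_SUP_iff)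
  then obtain b where b: "s < b" "ereal b < instant x0 k"
    using ereal_dense2[of "ereal s" "instant x0 k"] by auto
  have b_sup: "ereal b < (SUP k. instant x0 k)"
    using b(2) by (meson SUP_upper UNIV_I less_le_trans)
  \<comment> \<open>Near \<open>s\<close> the half-open domain coincides with a compact interval
    ending before some instant, where continuity came from gluing finitely many segments.\<close>
  have "at s within ?S = at s within {0..b}"
  proof (rule at_within_nhd[of s "{..<b}"])
    show "?S \<inter> {..<b} - {s} = {0..b} \<inter> {..<b} - {s}"
      using b_sup by (auto intro: less_trans[of _ "ereal b"])
  qed (use b in auto)
  moreover have "continuous (at s within {0..b}) (state x0)"
    using continuous_on_state_segment[of b x0 k] s b
    by (simp add: continuous_on_eq_continuous_within less_imp_le)
  ultimately show "continuous (at s within ?S) (state x0)" by simp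
qed

lemma state_derivative:
  assumes k: "instant x0 k = ereal a" and "a \<le> s" and s: "ereal s < instant x0 (Suc k)"
  shows "(state x0 has_vector_derivative (A *v state x0 s - (B ** K) *v state x0 a))
    (at s within {a..})"
proof -
  obtain b where b: "s < b" "ereal b < instant x0 (Suc k)"
    using ereal_dense2[OF s] by auto
  let ?f = "\<lambda>r. flow (held x0 k) (r - a)"
  have "((\<lambda>r. r - a) has_vector_derivative 1) (at s within {a..})"
    by (auto intro!: derivative_eq_intros)
  from vector_diff_chain_within[OF this flow_derivative[of "held x0 k" "s - a"]]
  have "(?f has_vector_derivative (A *v ?f s - (B ** K) *v held x0 k)) (at s within {a..})"
    by (simp add: o_def)
  \<comment> \<open>Because s < b, \<open>state\<close> agrees with the shifted flow near s to the
    right of \<open>a\<close>; at s = a this is only a one-sided neighbourhood.\<close>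
  then have "(state x0 has_vector_derivative (A *v ?f s - (B ** K) *v held x0 k)) (at s within {a..})"
  proof (rule has_vector_derivative_transform_within[where d = "b - s"])
    fix r assume r: "r \<in> {a..}" "dist r s < b - s"
    then have "r \<le> b" by (simp add: dist_real_def)
    then have "ereal r \<le> instant x0 (Suc k)" using b(2) by (auto intro: order_trans[of _ "ereal b"])
    then show "?f r = state x0 r" using state_eq_flow[OF k] r by simp
  qed (use b assms in auto)
  then show ?thesis
    using state_eq_flow[OF k \<open>a \<le> s\<close> less_imp_le[OF s]] state_instant[OF k] by simp
qed

lemma state_next_event:
  assumes k: "instant x0 k = ereal a"
  shows "next_event B K P \<sigma> (state x0) a (instant x0 (Suc k))"
proof -
  let ?y = "held x0 k" and ?D = "event_delay (held x0 k)"
  have D: "next_event B K P \<sigma> (flow ?y) 0 ?D" by (rule next_event_event_delay)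
  have T: "instant x0 (Suc k) = ereal a + ?D" using k by (simp add: instant_Suc)
  have xa: "state x0 a = ?y" by (rule state_instant[OF k])
  show ?thesis
  proof (cases "?y = 0")
    case True
    then have "?D = \<infinity>" using D by (simp add: next_event_def)
    then show ?thesis using True by (simp add: next_event_def T xa)
  next
    case False
    have "\<not> trigger B K P \<sigma> (state x0 s) (state x0 s - ?y)"
      if s: "a < s" "ereal s < instant x0 (Suc k)" for s
    proof -
      have "0 < s - a" "ereal (s - a) < ?D" using s T by (cases ?D; auto)+
      then have "\<not> trigger B K P \<sigma> (flow ?y (s - a)) (flow ?y (s - a) - ?y)"
        using D False by (simp add: next_event_def)
      then show ?thesis using state_eq_flow[OF k] s by simp
    qed
    moreover have "trigger B K P \<sigma> (state x0 s) (state x0 s - ?y)"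
      if s: "instant x0 (Suc k) = ereal s" for s
    proof -
      have "?D = ereal (s - a)" using s T by (cases ?D) auto
      then have "trigger B K P \<sigma> (flow ?y (s - a)) (flow ?y (s - a) - ?y)"
        using D False by (simp add: next_event_def)
      moreover have "a \<le> s" using instant_less_Suc[OF k] s by simp
      ultimately show ?thesis using state_eq_flow[OF k] s by simp
    qed
    ultimately show ?thesis
      using False instant_less_Suc[OF k] by (simp add: next_event_def xa)
  qed
qed

lemma trajectory_exists: "closed_loop_trajectory A B K P \<sigma> (instant x0) (state x0)"
  unfolding closed_loop_trajectory_def
  using continuous_on_state state_next_event state_derivative by (simp add: instant_Suc)

section \<open>From decay of V to stability and attractivity\<close>

lemma globally_asymptotically_stable_closed_loop:
  "globally_asymptotically_stable (closed_loop_trajectory A B K P \<sigma>)"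
proof -
  let ?traj = "closed_loop_trajectory A B K P \<sigma>"
  obtain C where C: "0 < C" "\<And>z. norm (P *v z) \<le> norm z * C"
    using bounded_linear.pos_bounded[OF matrix_vector_mul_bounded_linear[of P]] by blast
  have V_le: "x \<bullet> (P *v x) \<le> C * (norm x)\<^sup>2" for x
  proof -
    have "x \<bullet> (P *v x) \<le> norm x * norm (P *v x)" by (rule norm_cauchy_schwarz)
    also have "\<dots> \<le> norm x * (norm x * C)" by (intro mult_left_mono C) auto
    finally show ?thesis by (simp add: power2_eq_square algebra_simps)
  qed
  \<comment> \<open>Sandwiching V between p |x|^2 and C |x|^2 turns its decay into an exponential
    norm estimate, uniform over trajectories; stability and attractivity both follow from
    it.\<close>
  have bound: "(norm (x s))\<^sup>2 \<le> C / p * (norm (x 0))\<^sup>2 * exp (- c * s)"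
    if "?traj t x" "0 \<le> s" for t x s
  proof -
    have "exp (c * s) * (p * (norm (x s))\<^sup>2) \<le> exp (c * s) * (x s \<bullet> (P *v x s))"
      using p_bound[of "x s"] by (simp add: dot_square_norm)
    also have "\<dots> \<le> C * (norm (x 0))\<^sup>2"
      using trajectory_decay[OF that] V_le[of "x 0"] by linarith
    finally show ?thesis using p_pos by (simp add: exp_minus field_simps)
  qed
  have "\<exists>\<delta>>0. \<forall>t x. ?traj t x \<and> norm (x 0) < \<delta> \<longrightarrow> (\<forall>s\<ge>0. norm (x s) < \<epsilon>)"
    if "0 < \<epsilon>" for \<epsilon>
  proof (intro exI[of _ "\<epsilon> / sqrt (C / p)"] conjI allI impI)
    show "0 < \<epsilon> / sqrt (C / p)" using that C(1) p_pos by simp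
    fix t x s
    assume *: "?traj t x \<and> norm (x 0) < \<epsilon> / sqrt (C / p)" and s: "0 \<le> (s::real)"
    have "(norm (x s))\<^sup>2 \<le> C / p * (norm (x 0))\<^sup>2 * exp (- c * s)"
      using bound * s by blast
    also have "\<dots> \<le> C / p * (norm (x 0))\<^sup>2"
      using C(1) p_pos c_pos s by (intro mult_left_le) auto
    also have "\<dots> < C / p * (\<epsilon> / sqrt (C / p))\<^sup>2"
      using * C(1) p_pos by (intro mult_strict_left_mono power_strict_mono) auto
    also have "\<dots> = \<epsilon>\<^sup>2" using C(1) p_pos by (simp add: power_divide)
    finally show "norm (x s) < \<epsilon>" using that by (meson less_imp_le power2_less_imp_less)
  qed
  moreover have "(x \<longlongrightarrow> 0) at_top" if "?traj t x" for t x
  proof -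
    have "((\<lambda>s. exp (- c * s)) \<longlongrightarrow> 0) at_top"
      using c_pos by (intro filterlim_compose[OF exp_at_bot]
          filterlim_tendsto_neg_mult_at_bot[OF tendsto_const _ filterlim_ident]) simp
    then have "((\<lambda>s. C / p * (norm (x 0))\<^sup>2 * exp (- c * s)) \<longlongrightarrow> C / p * (norm (x 0))\<^sup>2 * 0) at_top"
      by (rule tendsto_mult_left)
    then have lim: "((\<lambda>s. C / p * (norm (x 0))\<^sup>2 * exp (- c * s)) \<longlongrightarrow> 0) at_top" by simp
    have "((\<lambda>s. (norm (x s))\<^sup>2) \<longlongrightarrow> 0) at_top"
    proof (rule tendsto_sandwich[OF _ _ tendsto_const lim])
      show "\<forall>\<^sub>F s in at_top. (norm (x s))\<^sup>2 \<le> C / p * (norm (x 0))\<^sup>2 * exp (- c * s)"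
        using eventually_ge_at_top[of 0] by (rule eventually_mono) (rule bound[OF that])
    qed simp
    then have "((\<lambda>s. sqrt ((norm (x s))\<^sup>2)) \<longlongrightarrow> sqrt 0) at_top"
      by (rule tendsto_real_sqrt)
    then show ?thesis by (simp add: tendsto_norm_zero_iff)
  qed
  moreover have "\<forall>x0. \<exists>t x. ?traj t x \<and> x 0 = x0"
    using trajectory_exists state_0 by blast
  ultimately show ?thesis
    unfolding globally_asymptotically_stable_def using trajectory_complete by blast
qed

end

theorem theorem1:
  fixes A :: "real^'n^'n" and B :: "real^'m^'n" and K :: "real^'n^'m"
    and P Q :: "real^'n^'n" and \<sigma> :: real
  assumes "stabilizable A B"
    and "hurwitz (A - B ** K)"
    and "symmetric Q" and "positive_definite Q"
    and "symmetric P" and "positive_definite P"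
    and "transpose (A - B ** K) ** P + P ** (A - B ** K) = - Q"
    and "0 < \<sigma>" and "\<sigma> < 1"
    and "\<sigma> < lambda_min Q / lambda_max P"
  shows "globally_asymptotically_stable (closed_loop_trajectory A B K P \<sigma>)"
proof -
  obtain p where p: "0 < p" "\<And>x. p * (x \<bullet> x) \<le> x \<bullet> (P *v x)"
    using positive_definite_lower_bound assms(5,6) by blast
  let ?H = "A - B ** K" and ?V = "\<lambda>x. x \<bullet> (P *v x)"
  \<comment> \<open>Both bounds on V are compared at a unit vector, making
    \<open>lambda_max P\<close> positive and hence safe to divide by.\<close>
  have "p \<le> lambda_max P"
  proof -
    let ?u = "axis undefined 1 :: real^'n"
    have "p * (?u \<bullet> ?u) \<le> lambda_max P * (?u \<bullet> ?u)"
      using p(2) rayleigh_le_lambda_max[OF assms(5)] by (rule order_trans)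
    then show ?thesis by (simp add: inner_axis_axis)
  qed
  then have max_pos: "0 < lambda_max P" using p(1) by simp
  have "0 < lambda_min Q / lambda_max P" using assms(8,10) by linarith
  then have min_pos: "0 < lambda_min Q" using max_pos by (simp add: zero_less_divide_iff)
  \<comment> \<open>V <= lambda_max P |x|^2 and lambda_min Q |x|^2 <= x . Q x combine to measure the
    dissipation in units of V.\<close>
  have Q_ge: "lambda_min Q / lambda_max P * ?V x \<le> x \<bullet> (Q *v x)" for x
  proof -
    have "?V x / lambda_max P \<le> x \<bullet> x"
      using rayleigh_le_lambda_max[OF assms(5), of x] max_pos by (simp add: field_simps)
    then have "lambda_min Q * (?V x / lambda_max P) \<le> lambda_min Q * (x \<bullet> x)"
      using min_pos by (intro mult_left_mono) auto
    also have "\<dots> \<le> x \<bullet> (Q *v x)" by (rule lambda_min_le_rayleigh[OF assms(3)])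
    finally show ?thesis by simp
  qed
  \<comment> \<open>Since P is symmetric, the two terms of the Lyapunov equation give the same
    scalar.\<close>
  have lyap: "2 * (x \<bullet> (P *v (?H *v x))) = - (x \<bullet> (Q *v x))" for x
  proof -
    have "x \<bullet> ((transpose ?H ** P) *v x) = (?H *v x) \<bullet> (P *v x)"
      by (metis dot_lmul_matrix inner_commute matrix_vector_mul_assoc transpose_matrix_vector)
    also have "\<dots> = x \<bullet> (P *v (?H *v x))"
      by (metis assms(5) inner_commute symmetric_inner_matrix_vector)
    finally have "x \<bullet> ((transpose ?H ** P + P ** ?H) *v x) = 2 * (x \<bullet> (P *v (?H *v x)))"
      by (simp add: matrix_vector_mult_add_rdistrib inner_add_right matrix_vector_mul_assoc)
    then show ?thesis by (simp add: assms(7) uminus_matrix_vector)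
  qed
  \<comment> \<open>The decay rate is exactly the gap in the assumed bound on sigma.\<close>
  interpret lyapunov_event_loop A B K P \<sigma> p "lambda_min Q / lambda_max P - \<sigma>"
  proof
    fix x e :: "real^'n"
    assume "\<not> trigger B K P \<sigma> x e"
    then have "2 * (x \<bullet> ((P ** B ** K) *v e)) < \<sigma> * ?V x" by (simp add: trigger_def)
    \<comment> \<open>As x - e is the held state, the vector field splits into the nominal closed
      loop and the error input B K e, which the triggering rule controls.\<close>
    moreover have "A *v x - (B ** K) *v (x - e) = ?H *v x + (B ** K) *v e"
      by (simp add: algebra_simps)
    then have "2 * (x \<bullet> (P *v (A *v x - (B ** K) *v (x - e))))
        = - (x \<bullet> (Q *v x)) + 2 * (x \<bullet> ((P ** B ** K) *v e))"
      using lyap[of x]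
      by (simp add: matrix_vector_right_distrib inner_add_right matrix_vector_mul_assoc matrix_mul_assoc)
    ultimately show "2 * (x \<bullet> (P *v (A *v x - (B ** K) *v (x - e))))
        \<le> - (lambda_min Q / lambda_max P - \<sigma>) * ?V x"
      using Q_ge[of x] by (simp add: algebra_simps)
  qed (use p assms in auto)
  show ?thesis by (rule globally_asymptotically_stable_closed_loop)
qed

end
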